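(* Let $f:\mathbb{R}\to\mathbb{R}^+$ be a (standardized) symmetric kernel and $\Pi:\mathbb{R}\times\mathbb{R}\to[0,1]$ a skewing function, let $\psi(z):=\partial_\delta\Pi(z,\delta)|_{\delta=0}$, not Lebesgue-almost everywhere zero, and let $\Psi$ be a primitive of $\psi$. Define the exponential family $$\mathcal E_\Psi:=\Big\{g_a:=\exp(-a\Psi)\Big/\int_{-\infty}^\infty\exp(-a\Psi(z))\,\mathrm dz\ \Big|\ a\in\mathcal A\Big\},\qquad \mathcal A:=\Big\{a\in\mathbb{R}:\int_{-\infty}^\infty\exp(-a\Psi(z))\,\mathrm dz<\infty\Big\}.$$ (1) If $(f,\Pi)$ satisfies Assumptions (A1$^+$) and (A2$^+$), then the $3\times3$ Fisher information matrix $\boldsymbol\Gamma_{f;\boldsymbol\vartheta_0}$ is singular for all $\boldsymbol\vartheta_0=(\mu,\sigma,0)'$, $\mu\in\mathbb{R}$, $\sigma>0$, if and only if $f\in\mathcal E_\Psi$. (2) If $(f,\Pi)$ satisfies Assumptions (A1) and (A2$^+$), then the $2\times2$ matrix $\boldsymbol\Gamma^0_{f;\boldsymbol\vartheta_0}$ is singular for all $\boldsymbol\vartheta_0=(\mu,\sigma,0)'$, $\mu\in\mathbb{R}$, $\sigma>0$, if and only if $f\in\mathcal E_\Psi$.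
   Context: Skew-symmetric family on $\mathbb{R}$: for $\boldsymbol\vartheta=(\mu,\sigma,\delta)'$ with $\mu\in\mathbb{R}$, $\sigma>0$, $\delta\in\mathbb{R}$, consider the density $x\mapsto f^\Pi_{\boldsymbol\vartheta}(x)=2\sigma^{-1}f(\sigma^{-1}(x-\mu))\,\Pi(\sigma^{-1}(x-\mu),\delta)$. Symmetric kernel: a p.d.f. $f$ on $\mathbb{R}$ with $f(z)=f(-z)\neq0$ for all $z\in\mathbb{R}$, standardized to have scale parameter one (for a notion of scale fixed once and for all, e.g. $\int z^2f(z)\,\mathrm dz=1$ or $\int_{-\infty}^1f(z)\,\mathrm dz=0.75$; the choice is arbitrary). Skewing function: $\Pi:\mathbb{R}\times\mathbb{R}\to[0,1]$ with $\Pi(-z,\delta)+\Pi(z,\delta)=1$ for all $z,\delta\in\mathbb{R}$ and $\Pi(z,0)=1/2$ for all $z\in\mathbb{R}$. Assumption (A1): $z\mapsto f(z)$ is differentiable, with derivative $\dot f$ such that, letting $\varphi_f:=-\dot f/f$, the quantity $\mathcal I_f:=\int_{-\infty}^\infty\varphi_f^2(z)f(z)\,\mathrm dz$ is finite. Assumption (A1$^+$): (A1) holds and, moreover, $\mathcal J_f:=\int_{-\infty}^\infty(z\varphi_f(z)-1)^2f(z)\,\mathrm dz$ is finite. Assumption (A2): (i) the mapping $z\mapsto\Pi(z,\delta)$ is differentiable, and its derivative equals $0$ at $\delta=0$; (ii) the mapping $\delta\mapsto\Pi(z,\delta)$ is differentiable at $\delta=0$ for all $z\in\mathbb{R}$,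 with derivative $\partial_\delta\Pi(z,\delta)|_{\delta=0}=:\psi(z)$ such that $z\mapsto\psi(z)$ admits a primitive $\Psi$ (i.e. $\Psi$ is differentiable with derivative $\psi$). Assumption (A2$^+$): (A2) holds and, moreover, $\int_{-\infty}^\infty\psi^2(z)f(z)\,\mathrm dz$ is finite. Information matrices at $\boldsymbol\vartheta_0=(\mu,\sigma,0)'$: $$\boldsymbol\Gamma_{f;\boldsymbol\vartheta_0}=\begin{pmatrix}\gamma^{11}&0&\gamma^{13}\\0&\gamma^{22}&0\\\gamma^{13}&0&\gamma^{33}\end{pmatrix},\qquad \boldsymbol\Gamma^0_{f;\boldsymbol\vartheta_0}=\begin{pmatrix}\gamma^{11}&\gamma^{13}\\\gamma^{13}&\gamma^{33}\end{pmatrix},$$ where $\gamma^{11}=\sigma^{-2}\mathcal I_f$, $\gamma^{22}=\sigma^{-2}\mathcal J_f$, $\gamma^{33}=4\int_{-\infty}^\infty\psi^2(z)f(z)\,\mathrm dz$, $\gamma^{13}=2\sigma^{-1}\int_{-\infty}^\infty\varphi_f(z)\psi(z)f(z)\,\mathrm dz$. The matrix $\boldsymbol\Gamma_{f;\boldsymbol\vartheta_0}$ is the Fisher information matrix for $(\mu,\sigma,\delta)$ in the family $f^\Pi_{\boldsymbol\vartheta}$ at $\delta=0$, and $\boldsymbol\Gamma^0_{f;\boldsymbol\vartheta_0}$ is its submatrix for $(\mu,\delta)$. *)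

theory Defs
  imports "HOL-Probability.Probability"
begin

definition is_pdf :: "(real \<Rightarrow> real) \<Rightarrow> bool" where
  "is_pdf f \<longleftrightarrow> (\<forall>x. 0 \<le> f x) \<and> has_bochner_integral lborel f 1"

definition symmetric_pdf :: "(real \<Rightarrow> real) \<Rightarrow> bool" where
  "symmetric_pdf f \<longleftrightarrow> is_pdf f \<and> (\<forall>z. f z = f (- z) \<and> f z \<noteq> 0)"

definition rescale :: "real \<Rightarrow> (real \<Rightarrow> real) \<Rightarrow> real \<Rightarrow> real" where
  "rescale \<sigma> f x = f (x / \<sigma>) / \<sigma>"

text \<open>The choice of a notion of scale is arbitrary, so it is a parameter: a positive,
  scale-equivariant functional \<open>s\<close>, defined on a class \<open>D\<close> of symmetric densities that is
  closed under rescaling (a class is needed since, e.g., the variance need not be finite).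
  The lemmas \<open>scale_functional_sd\<close> and \<open>scale_functional_quartile\<close> give the two
  usual examples.\<close>

definition scale_functional :: "(real \<Rightarrow> real) set \<Rightarrow> ((real \<Rightarrow> real) \<Rightarrow> real) \<Rightarrow> bool" where
  "scale_functional D s \<longleftrightarrow>
     (\<forall>f\<in>D. symmetric_pdf f \<and> s f > 0 \<and>
        (\<forall>\<sigma>>0. rescale \<sigma> f \<in> D \<and> s (rescale \<sigma> f) = \<sigma> * s f))"

definition symmetric_kernel ::
    "(real \<Rightarrow> real) set \<Rightarrow> ((real \<Rightarrow> real) \<Rightarrow> real) \<Rightarrow> (real \<Rightarrow> real) \<Rightarrow> bool" where
  "symmetric_kernel D s f \<longleftrightarrow> symmetric_pdf f \<and> f \<in> D \<and> s f = 1"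

definition skewing_function :: "(real \<Rightarrow> real \<Rightarrow> real) \<Rightarrow> bool" where
  "skewing_function P \<longleftrightarrow>
     (\<forall>z \<delta>. P z \<delta> \<in> {0..1}) \<and> (\<forall>z \<delta>. P (- z) \<delta> + P z \<delta> = 1) \<and> (\<forall>z. P z 0 = 1 / 2)"

definition phi :: "(real \<Rightarrow> real) \<Rightarrow> real \<Rightarrow> real" where
  "phi f z = - deriv f z / f z"

definition psi :: "(real \<Rightarrow> real \<Rightarrow> real) \<Rightarrow> real \<Rightarrow> real" where
  "psi P z = deriv (\<lambda>\<delta>. P z \<delta>) 0"

definition is_primitive :: "(real \<Rightarrow> real) \<Rightarrow> (real \<Rightarrow> real) \<Rightarrow> bool" where
  "is_primitive G g \<longleftrightarrow> (\<forall>z. (G has_real_derivative g z) (at z))"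

definition I_info :: "(real \<Rightarrow> real) \<Rightarrow> real" where
  "I_info f = (\<integral>z. (phi f z)\<^sup>2 * f z \<partial>lborel)"

definition J_info :: "(real \<Rightarrow> real) \<Rightarrow> real" where
  "J_info f = (\<integral>z. (z * phi f z - 1)\<^sup>2 * f z \<partial>lborel)"

definition A1 :: "(real \<Rightarrow> real) \<Rightarrow> bool" where
  "A1 f \<longleftrightarrow> (\<forall>z. f differentiable (at z)) \<and> integrable lborel (\<lambda>z. (phi f z)\<^sup>2 * f z)"

definition A1_plus :: "(real \<Rightarrow> real) \<Rightarrow> bool" where
  "A1_plus f \<longleftrightarrow> A1 f \<and> integrable lborel (\<lambda>z. (z * phi f z - 1)\<^sup>2 * f z)"

definition A2 :: "(real \<Rightarrow> real \<Rightarrow> real) \<Rightarrow> bool" where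
  "A2 P \<longleftrightarrow>
     (\<forall>\<delta> z. (\<lambda>z. P z \<delta>) differentiable (at z)) \<and> (\<forall>z. deriv (\<lambda>z. P z 0) z = 0) \<and>
     (\<forall>z. (\<lambda>\<delta>. P z \<delta>) differentiable (at 0)) \<and> (\<exists>\<Psi>. is_primitive \<Psi> (psi P))"

definition A2_plus :: "(real \<Rightarrow> real) \<Rightarrow> (real \<Rightarrow> real \<Rightarrow> real) \<Rightarrow> bool" where
  "A2_plus f P \<longleftrightarrow> A2 P \<and> integrable lborel (\<lambda>z. (psi P z)\<^sup>2 * f z)"

definition gamma11 :: "(real \<Rightarrow> real) \<Rightarrow> real \<Rightarrow> real" where
  "gamma11 f \<sigma> = I_info f / \<sigma>\<^sup>2"

definition gamma22 :: "(real \<Rightarrow> real) \<Rightarrow> real \<Rightarrow> real" where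
  "gamma22 f \<sigma> = J_info f / \<sigma>\<^sup>2"

definition gamma33 :: "(real \<Rightarrow> real) \<Rightarrow> (real \<Rightarrow> real \<Rightarrow> real) \<Rightarrow> real" where
  "gamma33 f P = 4 * (\<integral>z. (psi P z)\<^sup>2 * f z \<partial>lborel)"

definition gamma13 :: "(real \<Rightarrow> real) \<Rightarrow> (real \<Rightarrow> real \<Rightarrow> real) \<Rightarrow> real \<Rightarrow> real" where
  "gamma13 f P \<sigma> = 2 / \<sigma> * (\<integral>z. phi f z * psi P z * f z \<partial>lborel)"

text \<open>The entries below do not depend on the location \<open>\<mu>\<close>; it is kept as an argument since the
  matrices are indexed by the parameter point \<open>(\<mu>, \<sigma>, 0)\<close>. The lemmas
  \<open>fisher_information_Gamma\<close> and \<open>fisher_information_Gamma0\<close> identify them with the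
  Fisher information (second moments of the score) of the skew-symmetric family.\<close>

definition fisher_Gamma ::
    "(real \<Rightarrow> real) \<Rightarrow> (real \<Rightarrow> real \<Rightarrow> real) \<Rightarrow> real \<Rightarrow> real \<Rightarrow> real ^ 3 ^ 3" where
  "fisher_Gamma f P \<mu> \<sigma> = vector
     [vector [gamma11 f \<sigma>,   0,           gamma13 f P \<sigma>],
      vector [0,             gamma22 f \<sigma>, 0],
      vector [gamma13 f P \<sigma>, 0,           gamma33 f P]]"

definition fisher_Gamma0 ::
    "(real \<Rightarrow> real) \<Rightarrow> (real \<Rightarrow> real \<Rightarrow> real) \<Rightarrow> real \<Rightarrow> real \<Rightarrow> real ^ 2 ^ 2" where
  "fisher_Gamma0 f P \<mu> \<sigma> = vector
     [vector [gamma11 f \<sigma>,   gamma13 f P \<sigma>],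
      vector [gamma13 f P \<sigma>, gamma33 f P]]"

definition singular :: "real ^ 'n ^ 'n \<Rightarrow> bool" where
  "singular A \<longleftrightarrow> \<not> invertible A"

definition natural_params :: "(real \<Rightarrow> real) \<Rightarrow> real set" where
  "natural_params \<Psi> = {a. integrable lborel (\<lambda>z. exp (- a * \<Psi> z))}"

definition exp_family :: "(real \<Rightarrow> real) \<Rightarrow> (real \<Rightarrow> real) set" where
  "exp_family \<Psi> =
     {(\<lambda>x. exp (- a * \<Psi> x) / (\<integral>z. exp (- a * \<Psi> z) \<partial>lborel)) | a. a \<in> natural_params \<Psi>}"


subsection \<open>The matrices as Fisher information\<close>

definition skew_density ::
    "(real \<Rightarrow> real) \<Rightarrow> (real \<Rightarrow> real \<Rightarrow> real) \<Rightarrow> real ^ 3 \<Rightarrow> real \<Rightarrow> real" where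
  "skew_density f P \<theta> x =
     2 / \<theta> $ 2 * f ((x - \<theta> $ 1) / \<theta> $ 2) * P ((x - \<theta> $ 1) / \<theta> $ 2) (\<theta> $ 3)"

definition score :: "(real ^ 'n \<Rightarrow> real \<Rightarrow> real) \<Rightarrow> real ^ 'n \<Rightarrow> 'n \<Rightarrow> real \<Rightarrow> real" where
  "score p \<theta> i x = deriv (\<lambda>t. ln (p (\<theta> + t *\<^sub>R axis i 1) x)) 0"

definition fisher_information :: "(real ^ 'n \<Rightarrow> real \<Rightarrow> real) \<Rightarrow> real ^ 'n \<Rightarrow> real ^ 'n ^ 'n" where
  "fisher_information p \<theta> =
     (\<chi> i j. \<integral>x. score p \<theta> i x * score p \<theta> j x * p \<theta> x \<partial>lborel)"

lemma symmetric_pdf_pos: "symmetric_pdf f \<Longrightarrow> 0 < f z"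
  unfolding symmetric_pdf_def is_pdf_def by (metis order_le_less)

lemma score_skew_density:
  fixes \<mu> \<sigma> :: real
  assumes f: "symmetric_pdf f" and P: "skewing_function P" and "A1 f" "A2 P" and \<sigma>: "\<sigma> > 0"
  defines "\<theta> \<equiv> vector [\<mu>, \<sigma>, 0] :: real ^ 3"
  shows "score (skew_density f P) \<theta> 1 x = phi f ((x - \<mu>) / \<sigma>) / \<sigma>"
    and "score (skew_density f P) \<theta> 2 x = ((x - \<mu>) / \<sigma> * phi f ((x - \<mu>) / \<sigma>) - 1) / \<sigma>"
    and "score (skew_density f P) \<theta> 3 x = 2 * psi P ((x - \<mu>) / \<sigma>)"
    and "skew_density f P \<theta> x = f ((x - \<mu>) / \<sigma>) / \<sigma>"
proof -
  define z where "z = (x - \<mu>) / \<sigma>"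
  have P0: "P y 0 = 1 / 2" for y using P by (simp add: skewing_function_def)
  have th[simp]: "\<theta> $ 1 = \<mu>" "\<theta> $ 2 = \<sigma>" "\<theta> $ 3 = 0" by (simp_all add: \<theta>_def vector_3)
  have ax[simp]: "axis (1::3) (1::real) $ 1 = 1" "axis (1::3) (1::real) $ 2 = 0"
      "axis (1::3) (1::real) $ 3 = 0" "axis (2::3) (1::real) $ 1 = 0" "axis (2::3) (1::real) $ 2 = 1"
      "axis (2::3) (1::real) $ 3 = 0" "axis (3::3) (1::real) $ 1 = 0" "axis (3::3) (1::real) $ 2 = 0"
      "axis (3::3) (1::real) $ 3 = 1"
    by (simp_all add: axis_def)
  have df: "(f has_real_derivative deriv f z) (at z)"
    using \<open>A1 f\<close> by (simp add: A1_def DERIV_deriv_iff_real_differentiable)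
  have dP: "(P z has_real_derivative psi P z) (at 0)"
    using \<open>A2 P\<close> by (simp add: A2_def psi_def DERIV_deriv_iff_real_differentiable)
  have fp: "f z > 0" using symmetric_pdf_pos[OF f] .
  show "skew_density f P \<theta> x = f ((x - \<mu>) / \<sigma>) / \<sigma>"
    by (simp add: skew_density_def P0)
  have "((\<lambda>t. ln (f ((x - (\<mu> + t)) / \<sigma>) / \<sigma>)) has_real_derivative phi f z / \<sigma>) (at 0)"
    unfolding phi_def using \<sigma> fp df
    by (auto intro!: derivative_eq_intros DERIV_chain'[where g = f] simp: z_def field_simps)
  thus "score (skew_density f P) \<theta> 1 x = phi f ((x - \<mu>) / \<sigma>) / \<sigma>"
    by (auto simp: score_def skew_density_def P0 z_def intro!: DERIV_imp_deriv)
  have "((\<lambda>t. ln (2 / (\<sigma> + t) * f ((x - \<mu>) / (\<sigma> + t)) * (1 / 2))) has_real_derivative (z * phi f z - 1) / \<sigma>) (at 0)"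
    unfolding phi_def using \<sigma> fp df
    by (auto intro!: derivative_eq_intros DERIV_chain'[where g = f]
             simp: z_def field_simps power2_eq_square)
  thus "score (skew_density f P) \<theta> 2 x = ((x - \<mu>) / \<sigma> * phi f ((x - \<mu>) / \<sigma>) - 1) / \<sigma>"
    unfolding score_def skew_density_def by (intro DERIV_imp_deriv) (simp add: P0 z_def)
  have "((\<lambda>t. ln (2 / \<sigma> * f z * P z t)) has_real_derivative 2 * psi P z) (at 0)"
    using \<sigma> fp
    by (auto intro!: derivative_eq_intros dP simp: P0 field_simps)
  thus "score (skew_density f P) \<theta> 3 x = 2 * psi P ((x - \<mu>) / \<sigma>)"
    by (auto simp: score_def skew_density_def z_def intro!: DERIV_imp_deriv)
qed

lemma lborel_integral_location_scale:
  fixes g :: "real \<Rightarrow> real"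
  assumes "\<sigma> > 0"
  shows "(\<integral>x. g ((x - \<mu>) / \<sigma>) / \<sigma> \<partial>lborel) = (\<integral>z. g z \<partial>lborel)"
  using assms
  by (subst lborel_integral_real_affine[where c = \<sigma> and t = \<mu>]) (auto simp: field_simps)

lemma lborel_integral_odd:
  fixes g :: "real \<Rightarrow> real"
  assumes "\<And>z. g (- z) = - g z"
  shows "(\<integral>z. g z \<partial>lborel) = 0"
  using lborel_integral_real_affine[where c = "-1" and t = 0 and f = g] assms by simp

lemma phi_odd:
  assumes f: "symmetric_pdf f" and "A1 f"
  shows "phi f (- z) = - phi f z"
proof -
  have sym: "f (- y) = f y" for y using f by (simp add: symmetric_pdf_def)
  have "(f has_real_derivative deriv f z) (at z)"
    using \<open>A1 f\<close> by (simp add: A1_def DERIV_deriv_iff_real_differentiable)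
  hence "((\<lambda>y. f (- y)) has_real_derivative - deriv f z) (at (- z))"
    using DERIV_mirror[of f "deriv f z" "- z"] by simp
  hence "deriv f (- z) = - deriv f z"
    by (intro DERIV_imp_deriv) (simp add: sym)
  thus ?thesis by (simp add: phi_def sym)
qed

lemma psi_odd:
  assumes P: "skewing_function P" and "A2 P"
  shows "psi P (- z) = - psi P z"
proof -
  have "P (- z) d = 1 - P z d" for d
  proof -
    have "P (- z) d + P z d = 1" using P by (simp add: skewing_function_def)
    thus ?thesis by simp
  qed
  hence eq: "P (- z) = (\<lambda>d. 1 - P z d)" by auto
  have dP: "(P z has_real_derivative psi P z) (at 0)"
    using \<open>A2 P\<close> by (simp add: A2_def psi_def DERIV_deriv_iff_real_differentiable)
  have "(P (- z) has_real_derivative - psi P z) (at 0)"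
    unfolding eq by (auto intro!: derivative_eq_intros dP)
  thus ?thesis by (auto simp: psi_def[of P "- z"] intro!: DERIV_imp_deriv)
qed

lemma fisher_information_Gamma:
  assumes f: "symmetric_pdf f" and P: "skewing_function P" and "A1 f" "A2 P" and \<sigma>: "\<sigma> > 0"
  shows "fisher_information (skew_density f P) (vector [\<mu>, \<sigma>, 0]) = fisher_Gamma f P \<mu> \<sigma>"
proof -
  note sc = score_skew_density[OF assms]
  have sym: "f (- y) = f y" for y using f by (simp add: symmetric_pdf_def)
  note odd = phi_odd[OF f \<open>A1 f\<close>] psi_odd[OF P \<open>A2 P\<close>] sym
  define G where "G = (\<lambda>g. \<integral>z. g z * f z \<partial>lborel)"
  have G: "(\<integral>x. a x * b x * (f ((x - \<mu>) / \<sigma>) / \<sigma>) \<partial>lborel) = c * G g"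
    if "\<And>x. a x * b x = c * g ((x - \<mu>) / \<sigma>)" for a b g :: "real \<Rightarrow> real" and c
  proof -
    have "(\<integral>x. a x * b x * (f ((x - \<mu>) / \<sigma>) / \<sigma>) \<partial>lborel)
        = (\<integral>x. c * (g ((x - \<mu>) / \<sigma>) * f ((x - \<mu>) / \<sigma>) / \<sigma>) \<partial>lborel)"
      by (intro Bochner_Integration.integral_cong) (simp_all add: that)
    also have "\<dots> = c * G g"
      using lborel_integral_location_scale[OF \<sigma>, of "\<lambda>z. g z * f z" \<mu>]
      by (simp only: G_def integral_mult_right_zero)
    finally show ?thesis .
  qed
  have z12: "G (\<lambda>z. phi f z * (z * phi f z - 1)) = 0"
    unfolding G_def by (rule lborel_integral_odd) (simp add: odd algebra_simps)
  have z23: "G (\<lambda>z. (z * phi f z - 1) * psi P z) = 0"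
    unfolding G_def by (rule lborel_integral_odd) (simp add: odd algebra_simps)
  show ?thesis
    unfolding vec_eq_iff forall_3 fisher_information_def fisher_Gamma_def vec_lambda_beta sc vector_3
  proof (intro conjI)
    show "(\<integral>x. phi f ((x - \<mu>) / \<sigma>) / \<sigma> * (phi f ((x - \<mu>) / \<sigma>) / \<sigma>) * (f ((x - \<mu>) / \<sigma>) / \<sigma>) \<partial>lborel)
        = gamma11 f \<sigma>"
      by (subst G[where c = "1 / \<sigma>\<^sup>2" and g = "\<lambda>z. (phi f z)\<^sup>2"])
         (simp_all add: gamma11_def I_info_def G_def power2_eq_square)
  next
    show "(\<integral>x. phi f ((x - \<mu>) / \<sigma>) / \<sigma> * (((x - \<mu>) / \<sigma> * phi f ((x - \<mu>) / \<sigma>) - 1) / \<sigma>)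
           * (f ((x - \<mu>) / \<sigma>) / \<sigma>) \<partial>lborel) = 0"
      by (subst G[where c = "1 / \<sigma>\<^sup>2" and g = "\<lambda>z. phi f z * (z * phi f z - 1)"])
         (simp_all add: z12 power2_eq_square)
  next
    show "(\<integral>x. phi f ((x - \<mu>) / \<sigma>) / \<sigma> * (2 * psi P ((x - \<mu>) / \<sigma>)) * (f ((x - \<mu>) / \<sigma>) / \<sigma>) \<partial>lborel)
        = gamma13 f P \<sigma>"
      by (subst G[where c = "2 / \<sigma>" and g = "\<lambda>z. phi f z * psi P z"])
         (simp_all add: gamma13_def G_def)
  next
    show "(\<integral>x. ((x - \<mu>) / \<sigma> * phi f ((x - \<mu>) / \<sigma>) - 1) / \<sigma> * (phi f ((x - \<mu>) / \<sigma>) / \<sigma>)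
           * (f ((x - \<mu>) / \<sigma>) / \<sigma>) \<partial>lborel) = 0"
      by (subst G[where c = "1 / \<sigma>\<^sup>2" and g = "\<lambda>z. phi f z * (z * phi f z - 1)"])
         (simp_all add: z12 power2_eq_square)
  next
    show "(\<integral>x. ((x - \<mu>) / \<sigma> * phi f ((x - \<mu>) / \<sigma>) - 1) / \<sigma> *
              (((x - \<mu>) / \<sigma> * phi f ((x - \<mu>) / \<sigma>) - 1) / \<sigma>) * (f ((x - \<mu>) / \<sigma>) / \<sigma>) \<partial>lborel)
        = gamma22 f \<sigma>"
      by (subst G[where c = "1 / \<sigma>\<^sup>2" and g = "\<lambda>z. (z * phi f z - 1)\<^sup>2"])
         (simp_all add: gamma22_def J_info_def G_def power2_eq_square)
  next
    show "(\<integral>x. ((x - \<mu>) / \<sigma> * phi f ((x - \<mu>) / \<sigma>) - 1) / \<sigma> * (2 * psi P ((x - \<mu>) / \<sigma>))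
           * (f ((x - \<mu>) / \<sigma>) / \<sigma>) \<partial>lborel) = 0"
      by (subst G[where c = "2 / \<sigma>" and g = "\<lambda>z. (z * phi f z - 1) * psi P z"])
         (simp_all add: z23)
  next
    show "(\<integral>x. 2 * psi P ((x - \<mu>) / \<sigma>) * (phi f ((x - \<mu>) / \<sigma>) / \<sigma>) * (f ((x - \<mu>) / \<sigma>) / \<sigma>) \<partial>lborel)
        = gamma13 f P \<sigma>"
      by (subst G[where c = "2 / \<sigma>" and g = "\<lambda>z. phi f z * psi P z"])
         (simp_all add: gamma13_def G_def)
  next
    show "(\<integral>x. 2 * psi P ((x - \<mu>) / \<sigma>) * (((x - \<mu>) / \<sigma> * phi f ((x - \<mu>) / \<sigma>) - 1) / \<sigma>)
           * (f ((x - \<mu>) / \<sigma>) / \<sigma>) \<partial>lborel) = 0"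
      by (subst G[where c = "2 / \<sigma>" and g = "\<lambda>z. (z * phi f z - 1) * psi P z"])
         (simp_all add: z23)
  next
    show "(\<integral>x. 2 * psi P ((x - \<mu>) / \<sigma>) * (2 * psi P ((x - \<mu>) / \<sigma>)) * (f ((x - \<mu>) / \<sigma>) / \<sigma>) \<partial>lborel)
        = gamma33 f P"
      by (subst G[where c = 4 and g = "\<lambda>z. (psi P z)\<^sup>2"])
         (simp_all add: gamma33_def G_def power2_eq_square)
  qed
qed

lemma fisher_information_Gamma0:
  fixes \<mu> \<sigma> :: real
  assumes "symmetric_pdf f" "skewing_function P" "A1 f" "A2 P" "\<sigma> > 0"
  defines "F \<equiv> fisher_information (skew_density f P) (vector [\<mu>, \<sigma>, 0])"
  shows "fisher_Gamma0 f P \<mu> \<sigma> = vector [vector [F $ 1 $ 1, F $ 1 $ 3], vector [F $ 3 $ 1, F $ 3 $ 3]]"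
  unfolding F_def fisher_information_Gamma[OF assms(1-5)]
  by (simp add: fisher_Gamma0_def fisher_Gamma_def vector_3)


subsection \<open>Examples of scale functionals\<close>

lemma is_pdf_rescale:
  assumes "is_pdf f" "\<sigma> > 0"
  shows "is_pdf (rescale \<sigma> f)"
proof -
  have f: "has_bochner_integral lborel f 1" "\<And>x. 0 \<le> f x" using assms(1) by (auto simp: is_pdf_def)
  have "has_bochner_integral lborel (\<lambda>x. f (0 + (1 / \<sigma>) * x)) (1 /\<^sub>R \<bar>1 / \<sigma>\<bar>)"
    using assms(2) f(1) by (subst lborel_has_bochner_integral_real_affine_iff[symmetric]) auto
  hence "has_bochner_integral lborel (\<lambda>x. f (0 + (1 / \<sigma>) * x) / \<sigma>) ((1 /\<^sub>R \<bar>1 / \<sigma>\<bar>) / \<sigma>)"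
    by (rule has_bochner_integral_divide_zero)
  thus ?thesis using f(2) assms(2) by (simp add: is_pdf_def rescale_def[abs_def])
qed

lemma symmetric_pdf_rescale:
  assumes "symmetric_pdf f" "\<sigma> > 0"
  shows "symmetric_pdf (rescale \<sigma> f)"
  using assms is_pdf_rescale[of f \<sigma>] by (auto simp: symmetric_pdf_def rescale_def)

lemma scale_functional_sd:
  "scale_functional {f. symmetric_pdf f \<and> integrable lborel (\<lambda>z. z\<^sup>2 * f z)}
     (\<lambda>f. sqrt (\<integral>z. z\<^sup>2 * f z \<partial>lborel))"
  unfolding scale_functional_def
proof (intro ballI conjI allI impI CollectI; clarify?)
  fix f :: "real \<Rightarrow> real" assume f: "symmetric_pdf f" "integrable lborel (\<lambda>z. z\<^sup>2 * f z)"
  have pos: "f z > 0" for z using f(1) by (rule symmetric_pdf_pos)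
  have nn: "0 \<le> (\<integral>z. z\<^sup>2 * f z \<partial>lborel)"
    by (intro integral_nonneg_AE) (simp add: pos less_imp_le)
  have "(\<integral>z. z\<^sup>2 * f z \<partial>lborel) \<noteq> 0"
  proof
    assume "(\<integral>z. z\<^sup>2 * f z \<partial>lborel) = 0"
    hence "AE z in lborel. z\<^sup>2 * f z = 0"
      by (subst (asm) integral_nonneg_eq_0_iff_AE[OF f(2)]) (auto simp: pos less_imp_le)
    hence "AE z in lborel. z \<in> {0::real}" by eventually_elim (use pos in \<open>auto simp: less_le\<close>)
    moreover have "AE z in lborel. z \<noteq> (0::real)" by (rule AE_lborel_singleton)
    ultimately have "AE z in (lborel :: real measure). False" by eventually_elim auto
    thus False by (simp add: AE_iff_measurable[of UNIV])
  qed
  with nn show "0 < sqrt (\<integral>z. z\<^sup>2 * f z \<partial>lborel)" by simp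
  fix \<sigma> :: real assume \<sigma>: "\<sigma> > 0"
  show "symmetric_pdf (rescale \<sigma> f)" using f(1) \<sigma> by (rule symmetric_pdf_rescale)
  have eq: "z\<^sup>2 * rescale \<sigma> f z = \<sigma> * ((z / \<sigma>)\<^sup>2 * f (z / \<sigma>))" for z
    using \<sigma> by (simp add: rescale_def field_simps power2_eq_square)
  show "integrable lborel (\<lambda>z. z\<^sup>2 * rescale \<sigma> f z)"
    unfolding eq using lborel_integrable_real_affine[OF f(2), of "1 / \<sigma>" 0] \<sigma> by simp
  have "(\<integral>z. z\<^sup>2 * rescale \<sigma> f z \<partial>lborel)
      = (\<integral>z. \<sigma>\<^sup>2 * (((z - 0) / \<sigma>)\<^sup>2 * f ((z - 0) / \<sigma>) / \<sigma>) \<partial>lborel)"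
    unfolding eq using \<sigma> by (simp add: power2_eq_square)
  also have "\<dots> = \<sigma>\<^sup>2 * (\<integral>z. z\<^sup>2 * f z \<partial>lborel)"
    using lborel_integral_location_scale[OF \<sigma>, of "\<lambda>z. z\<^sup>2 * f z" 0]
    by (simp only: integral_mult_right_zero)
  finally show "sqrt (\<integral>z. z\<^sup>2 * rescale \<sigma> f z \<partial>lborel) = \<sigma> * sqrt (\<integral>z. z\<^sup>2 * f z \<partial>lborel)"
    using \<sigma> by (simp add: real_sqrt_mult)
qed

lemma upper_quartile:
  assumes "symmetric_pdf f"
  shows "\<exists>!q. (LINT z:{..q}|lborel. f z) = 3 / 4"
    and "(LINT z:{..q}|lborel. f z) = 3 / 4 \<Longrightarrow> q > 0"
proof -
  define F where "F q = (LINT z:{..q}|lborel. f z)" for q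
  have pos: "f z > 0" for z using assms by (rule symmetric_pdf_pos)
  have int: "integrable lborel f" and one: "(\<integral>z. f z \<partial>lborel) = 1"
    using assms by (auto simp: symmetric_pdf_def is_pdf_def has_bochner_integral_iff)
  have [measurable]: "f \<in> borel_measurable borel" using int by simp
  have sint: "set_integrable lborel A f" if "A \<in> sets borel" for A
    using that integrable_mult_indicator[OF _ int, of A] by (simp add: set_integrable_def)
  define M where "M = density lborel f"
  have mM: "measure M A = (LINT z:A|lborel. f z)" if [measurable]: "A \<in> sets borel" for A
  proof -
    have "emeasure M A = (\<integral>\<^sup>+z. ennreal (indicator A z * f z) \<partial>lborel)"
      by (auto simp: M_def emeasure_density mult.commute indicator_def intro!: nn_integral_cong)
    also have "\<dots> = ennreal (LINT z:A|lborel. f z)"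
      unfolding set_lebesgue_integral_def real_scaleR_def
      using sint[OF that]
      by (intro nn_integral_eq_integral) (auto simp: set_integrable_def pos less_imp_le)
    finally have "emeasure M A = ennreal (LINT z:A|lborel. f z)" .
    moreover have "0 \<le> (LINT z:A|lborel. f z)"
      unfolding set_lebesgue_integral_def
      by (intro integral_nonneg_AE) (simp add: pos less_imp_le)
    ultimately show ?thesis by (simp add: measure_def)
  qed
  have "emeasure M UNIV = 1"
    unfolding M_def using int one
    by (simp add: emeasure_density nn_integral_eq_integral pos less_imp_le)
  hence "prob_space M" by (intro prob_spaceI) (simp add: M_def)
  interpret real_distribution M
    by (rule real_distribution.intro[OF \<open>prob_space M\<close>], unfold_locales) (auto simp: M_def)
  have cdf: "cdf M = F" by (auto simp: cdf_def F_def mM)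
  have strict: "F a < F b" if "a < b" for a b
  proof -
    have "F b = F a + (LINT z:{a<..b}|lborel. f z)"
      unfolding F_def using that
      by (subst set_integral_Un[symmetric]) (auto intro!: sint simp: ivl_disj_un)
    moreover have "(LINT z:{a<..b}|lborel. f z) \<noteq> 0"
    proof
      assume "(LINT z:{a<..b}|lborel. f z) = 0"
      hence "AE z in lborel. indicator {a<..b} z * f z = 0"
        unfolding set_lebesgue_integral_def real_scaleR_def using sint[of "{a<..b}"]
        by (subst (asm) integral_nonneg_eq_0_iff_AE)
           (auto simp: set_integrable_def pos less_imp_le)
      hence "AE z in lborel. z \<notin> {a<..b}"
        by eventually_elim (use pos in \<open>auto simp: less_le indicator_def split: if_splits\<close>)
      hence "emeasure lborel {a<..b} = 0"
        by (subst (asm) AE_iff_measurable[of "{a<..b}"]) auto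
      thus False using that by simp
    qed
    moreover have "(LINT z:{a<..b}|lborel. f z) \<ge> 0"
      unfolding set_lebesgue_integral_def
      by (intro integral_nonneg_AE) (auto simp: pos less_imp_le)
    ultimately show ?thesis by simp
  qed
  have half: "F 0 = 1 / 2"
  proof -
    have "F 0 = (LINT z:{0..}|lborel. f z)"
      unfolding F_def set_lebesgue_integral_def
      using lborel_integral_real_affine[where c = "-1" and t = 0 and f = "\<lambda>z. indicator {..0::real} z *\<^sub>R f z"]
        assms by (simp add: symmetric_pdf_def indicator_def)
    also have "\<dots> = (LINT z:{0<..}|lborel. f z)"
      unfolding set_lebesgue_integral_def
      by (intro integral_cong_AE eventually_mono[OF AE_lborel_singleton[of 0]])
         (simp_all add: indicator_def)
    finally have "F 0 + F 0 = (LINT z:{..0} \<union> {0<..}|lborel. f z)"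
      by (subst set_integral_Un) (auto intro!: sint simp: F_def)
    also have "{..0} \<union> {0<..} = (UNIV :: real set)" by auto
    finally show ?thesis by (simp add: set_lebesgue_integral_def one)
  qed
  have cont: "isCont F x" for x
  proof -
    have "(LINT z:{x}|lborel. f z) = (\<integral>z. 0 \<partial>(lborel :: real measure))"
      unfolding set_lebesgue_integral_def
      by (intro integral_cong_AE eventually_mono[OF AE_lborel_singleton[of x]])
         (simp_all add: indicator_def)
    thus ?thesis using isCont_cdf[of x] by (simp add: cdf mM)
  qed
  have "eventually (\<lambda>x. 3 / 4 < F x) at_top"
    using cdf_lim_at_top_prob unfolding cdf by (rule order_tendstoD) simp
  then obtain N where "\<And>n. n \<ge> N \<Longrightarrow> 3 / 4 < F n"
    unfolding eventually_at_top_linorder by auto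
  hence b: "3 / 4 < F (max N 0)" by simp
  have "\<exists>q\<ge>0. q \<le> max N 0 \<and> F q = 3 / 4"
    by (rule IVT') (use half b cont continuous_at_imp_continuous_on in auto)
  then obtain r where r: "F r = 3 / 4" by blast
  show "\<exists>!q. (LINT z:{..q}|lborel. f z) = 3 / 4"
  proof (rule ex1I[of _ r])
    show "(LINT z:{..r}|lborel. f z) = 3 / 4" using r by (simp add: F_def)
    fix y assume "(LINT z:{..y}|lborel. f z) = 3 / 4"
    hence "F y = F r" using r by (simp add: F_def)
    thus "y = r" using strict[of y r] strict[of r y] by (cases y r rule: linorder_cases) auto
  qed
  show "q > 0" if "(LINT z:{..q}|lborel. f z) = 3 / 4"
  proof (rule ccontr)
    assume "\<not> q > 0"
    hence "F q \<le> F 0" using strict[of q 0] by (cases "q = 0") auto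
    thus False using that half by (simp add: F_def)
  qed
qed

lemma scale_functional_quartile:
  "scale_functional {f. symmetric_pdf f} (\<lambda>f. THE q. (LINT z:{..q}|lborel. f z) = 3 / 4)"
  unfolding scale_functional_def
proof (intro ballI conjI allI impI CollectI; clarify?)
  fix f :: "real \<Rightarrow> real" assume f: "symmetric_pdf f"
  define q where "q = (THE q. (LINT z:{..q}|lborel. f z) = 3 / 4)"
  have q: "(LINT z:{..q}|lborel. f z) = 3 / 4"
    unfolding q_def using upper_quartile(1)[OF f] by (rule theI')
  show "q > 0" using upper_quartile(2)[OF f q] .
  fix \<sigma> :: real assume \<sigma>: "\<sigma> > 0"
  show rf: "symmetric_pdf (rescale \<sigma> f)" using f \<sigma> by (rule symmetric_pdf_rescale)
  have "(LINT z:{..\<sigma> * q}|lborel. rescale \<sigma> f z)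
      = (\<integral>z. indicator {..q} ((z - 0) / \<sigma>) * f ((z - 0) / \<sigma>) / \<sigma> \<partial>lborel)"
    unfolding set_lebesgue_integral_def using \<sigma>
    by (intro Bochner_Integration.integral_cong)
       (auto simp: rescale_def indicator_def field_simps)
  also have "\<dots> = (LINT z:{..q}|lborel. f z)"
    using lborel_integral_location_scale[OF \<sigma>, of "\<lambda>z. indicator {..q} z * f z" 0]
    by (simp add: set_lebesgue_integral_def)
  finally show "(THE q. (LINT z:{..q}|lborel. rescale \<sigma> f z) = 3 / 4) = \<sigma> * q"
    using q upper_quartile(1)[OF rf] by (intro the1_equality) auto
qed

end

theory Submission
  imports Defs
begin

text \<open>Up to a positive factor, the determinant of the \<open>(\<mu>, \<delta>)\<close> block is the Gram
  determinant of \<open>\<phi>\<^sub>f\<close> and \<open>\<psi>\<close> in \<open>L\<^sup>2(f)\<close>. As \<open>\<psi>\<close> does not vanish almost everywhere, it is zero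
  exactly when \<open>\<phi>\<^sub>f = c \<psi>\<close> almost everywhere for some constant \<open>c\<close>
  (\<open>AE_proportional_if_gram_eq\<close>). Both sides have primitives, \<open>- ln f\<close> and \<open>c \<Psi>\<close>, so
  \<open>ln f + c \<Psi>\<close> is differentiable everywhere with derivative zero almost everywhere. Such a
  function is constant (\<open>constant_if_derivative_AE_zero\<close>), although \<open>\<phi>\<^sub>f\<close> and \<open>\<psi>\<close> need not be
  continuous or locally Lebesgue integrable; hence \<open>f\<close> is a multiple of \<open>exp (- c \<Psi>)\<close>, and
  normalization makes it a member of the exponential family. Conversely, for such a member
  \<open>\<phi>\<^sub>f = a \<psi>\<close> holds everywhere.

  The scale component adds only the factor \<open>\<J>\<^sub>f / \<sigma>\<^sup>2\<close> to the full determinant, because the matrix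
  decouples by parity. This factor never vanishes: \<open>\<J>\<^sub>f = 0\<close> would mean
  \<open>(z f(z))' = 0\<close> almost everywhere, so by the same principle \<open>z f(z)\<close> would be
  constant, equal to its value \<open>0\<close> at the origin.\<close>

section \<open>Functions with almost everywhere vanishing derivative\<close>

text \<open>The derivative need not be Lebesgue integrable a priori, but the gauge integral recovers
  increments from any everywhere defined derivative, and it ignores null sets. Almost everywhere
  differentiability would not suffice, as the Cantor function shows.\<close>

lemma constant_if_derivative_AE_zero:
  fixes h h' :: "real \<Rightarrow> real"
  assumes deriv: "\<And>z. (h has_real_derivative h' z) (at z)"
    and zero: "AE z in lborel. h' z = 0"
  shows "h x = h y"
proof -
  have le: "h a = h b" if "a \<le> b" for a b
  proof -
    obtain N where null: "N \<in> null_sets lborel" and N: "\<And>z. z \<notin> N \<Longrightarrow> h' z = 0"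
    proof (rule AE_E3[OF zero])
      fix N assume "\<And>z. z \<in> space lborel - N \<Longrightarrow> h' z = 0" "N \<in> null_sets lborel"
      thus thesis by (intro that) simp_all
    qed
    from null have neg: "negligible N"
      by (simp add: negligible_iff_null_sets null_sets_completionI)
    have "(h' has_integral (h b - h a)) {a..b}"
      using that deriv
      by (intro fundamental_theorem_of_calculus)
         (auto simp flip: has_real_derivative_iff_has_vector_derivative
               intro: has_field_derivative_at_within)
    moreover have "(h' has_integral 0) {a..b}"
      by (rule has_integral_spike[OF neg _ has_integral_0]) (use N in auto)
    ultimately have "h b - h a = 0" by (rule has_integral_unique)
    thus ?thesis by simp
  qed
  show ?thesis using le[of x y] le[of y x] by linarith
qed

lemma borel_measurable_derivative:
  fixes h h' :: "real \<Rightarrow> real"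
  assumes deriv: "\<And>z. (h has_real_derivative h' z) (at z)"
  shows "h' \<in> borel_measurable borel"
proof (rule borel_measurable_LIMSEQ_real)
  have "continuous_on UNIV h"
    using deriv by (auto simp: continuous_on_eq_continuous_at intro: DERIV_isCont)
  hence [measurable]: "h \<in> borel_measurable borel"
    by (rule borel_measurable_continuous_onI)
  show "(\<lambda>z. (h (z + inverse (real (Suc n))) - h z) / inverse (real (Suc n)))
          \<in> borel_measurable borel" for n
    by measurable
  fix z
  have "((\<lambda>e. (h (z + e) - h z) / e) \<longlongrightarrow> h' z) (at 0)"
    using deriv[of z] by (simp add: DERIV_def)
  moreover have "filterlim (\<lambda>n. inverse (real (Suc n))) (at 0) sequentially"
    by (simp add: filterlim_at LIMSEQ_inverse_real_of_nat del: of_nat_Suc)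
  ultimately show "(\<lambda>n. (h (z + inverse (real (Suc n))) - h z) / inverse (real (Suc n)))
        \<longlonglongrightarrow> h' z"
    by (rule filterlim_compose)
qed

section \<open>Equality in the weighted Cauchy--Schwarz inequality\<close>

lemma AE_zero_if_weighted_square_integral_zero:
  fixes f u :: "real \<Rightarrow> real"
  assumes pos: "\<And>z. f z > 0"
    and int: "integrable lborel (\<lambda>z. (u z)\<^sup>2 * f z)"
    and zero: "(\<integral>z. (u z)\<^sup>2 * f z \<partial>lborel) = 0"
  shows "AE z in lborel. u z = 0"
proof -
  have "AE z in lborel. (u z)\<^sup>2 * f z = 0"
    using zero by (subst (asm) integral_nonneg_eq_0_iff_AE[OF int]) (auto simp: pos less_imp_le)
  thus ?thesis
    by eventually_elim (use pos in \<open>auto simp: less_le\<close>)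
qed

lemma integrable_weighted_product:
  fixes f u v :: "real \<Rightarrow> real"
  assumes pos: "\<And>z. f z > 0"
    and [measurable]: "f \<in> borel_measurable borel" "u \<in> borel_measurable borel"
      "v \<in> borel_measurable borel"
    and u: "integrable lborel (\<lambda>z. (u z)\<^sup>2 * f z)"
    and v: "integrable lborel (\<lambda>z. (v z)\<^sup>2 * f z)"
  shows "integrable lborel (\<lambda>z. u z * v z * f z)"
proof (rule Bochner_Integration.integrable_bound)
  show "integrable lborel (\<lambda>z. (u z)\<^sup>2 * f z + (v z)\<^sup>2 * f z)"
    using u v by simp
  show "AE z in lborel. norm (u z * v z * f z) \<le> norm ((u z)\<^sup>2 * f z + (v z)\<^sup>2 * f z)"
  proof (intro AE_I2)
    fix z
    have "2 * (\<bar>u z\<bar> * \<bar>v z\<bar>) \<le> (u z)\<^sup>2 + (v z)\<^sup>2"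
      using sum_squares_bound[of "\<bar>u z\<bar>" "\<bar>v z\<bar>"] by (simp add: mult.assoc)
    moreover have "0 \<le> \<bar>u z\<bar> * \<bar>v z\<bar>" by simp
    ultimately have "\<bar>u z\<bar> * \<bar>v z\<bar> \<le> (u z)\<^sup>2 + (v z)\<^sup>2" by linarith
    hence "\<bar>u z\<bar> * \<bar>v z\<bar> * f z \<le> ((u z)\<^sup>2 + (v z)\<^sup>2) * f z"
      using pos[of z] by (intro mult_right_mono) auto
    thus "norm (u z * v z * f z) \<le> norm ((u z)\<^sup>2 * f z + (v z)\<^sup>2 * f z)"
      using pos[of z] by (simp add: abs_mult distrib_right)
  qed
qed measurable

text \<open>For \<open>c\<close> the coefficient of the orthogonal projection of \<open>u\<close> onto \<open>v\<close> in \<open>L\<^sup>2(f)\<close>, the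
  squared norm of \<open>u - c v\<close> is the Gram determinant divided by the squared norm of \<open>v\<close>.\<close>

lemma AE_proportional_if_gram_eq:
  fixes f u v :: "real \<Rightarrow> real"
  assumes pos: "\<And>z. f z > 0"
    and meas: "f \<in> borel_measurable borel" "u \<in> borel_measurable borel"
      "v \<in> borel_measurable borel"
    and u: "integrable lborel (\<lambda>z. (u z)\<^sup>2 * f z)"
    and v: "integrable lborel (\<lambda>z. (v z)\<^sup>2 * f z)"
    and nz: "\<not> (AE z in lborel. v z = 0)"
    and gram: "(\<integral>z. (u z)\<^sup>2 * f z \<partial>lborel) * (\<integral>z. (v z)\<^sup>2 * f z \<partial>lborel)
      = (\<integral>z. u z * v z * f z \<partial>lborel)\<^sup>2"
  shows "\<exists>c. AE z in lborel. u z = c * v z"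
proof -
  define A where "A = (\<integral>z. (u z)\<^sup>2 * f z \<partial>lborel)"
  define B where "B = (\<integral>z. (v z)\<^sup>2 * f z \<partial>lborel)"
  define C where "C = (\<integral>z. u z * v z * f z \<partial>lborel)"
  define c where "c = C / B"
  note uv = integrable_weighted_product[OF pos meas u v]
  have "B \<noteq> 0"
    using AE_zero_if_weighted_square_integral_zero[of f v, OF pos v] nz by (auto simp: B_def)
  have expand: "(u z - c * v z)\<^sup>2 * f z
      = (u z)\<^sup>2 * f z - 2 * c * (u z * v z * f z) + c\<^sup>2 * ((v z)\<^sup>2 * f z)" for z
    by (simp add: power2_eq_square algebra_simps)
  have int: "integrable lborel (\<lambda>z. (u z - c * v z)\<^sup>2 * f z)"
    unfolding expand using u v uv by simp
  have "(\<integral>z. (u z - c * v z)\<^sup>2 * f z \<partial>lborel) = A - 2 * c * C + c\<^sup>2 * B"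
    unfolding expand A_def B_def C_def using u v uv by simp
  also have "\<dots> = (A * B - C\<^sup>2) / B"
    using \<open>B \<noteq> 0\<close> by (simp add: c_def power2_eq_square field_simps)
  also have "\<dots> = 0"
    using gram by (simp add: A_def B_def C_def)
  finally have "AE z in lborel. u z - c * v z = 0"
    by (rule AE_zero_if_weighted_square_integral_zero[of f, OF pos int])
  thus ?thesis by auto
qed

section \<open>Membership in the exponential family\<close>

lemma minus_ln_has_derivative_phi:
  assumes pos: "\<And>z. f z > 0" and "A1 f"
  shows "((\<lambda>z. - ln (f z)) has_real_derivative phi f z) (at z)"
proof -
  have "(f has_real_derivative deriv f z) (at z)"
    using \<open>A1 f\<close> by (simp add: A1_def DERIV_deriv_iff_real_differentiable)
  thus ?thesis
    using pos[of z] by (auto simp: phi_def divide_simps intro!: derivative_eq_intros)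
qed

lemma exp_family_if_AE_phi_proportional:
  assumes f: "symmetric_pdf f" and "A1 f" and prim: "is_primitive \<Psi> g"
    and phi_eq: "AE z in lborel. phi f z = c * g z"
  shows "f \<in> exp_family \<Psi>"
proof -
  have pos: "f z > 0" for z using f by (rule symmetric_pdf_pos)
  have int: "integrable lborel f" and one: "(\<integral>z. f z \<partial>lborel) = 1"
    using f by (auto simp: symmetric_pdf_def is_pdf_def has_bochner_integral_iff)
  define h where "h z = - ln (f z) - c * \<Psi> z" for z
  have "(h has_real_derivative (phi f z - c * g z)) (at z)" for z
    unfolding h_def using prim
    by (intro DERIV_diff DERIV_cmult minus_ln_has_derivative_phi pos \<open>A1 f\<close>)
       (simp add: is_primitive_def)
  moreover have "AE z in lborel. phi f z - c * g z = 0"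
    using phi_eq by simp
  ultimately have const: "h z = h 0" for z
    by (rule constant_if_derivative_AE_zero)
  define K where "K = exp (- h 0)"
  have feq: "f z = K * exp (- c * \<Psi> z)" for z
  proof -
    have "ln (f z) = - h 0 + - c * \<Psi> z"
      using const[of z] by (simp add: h_def)
    hence "exp (ln (f z)) = K * exp (- c * \<Psi> z)"
      by (simp only: K_def exp_add)
    thus ?thesis using pos[of z] by simp
  qed
  have K: "K > 0" by (simp add: K_def)
  have expeq: "exp (- c * \<Psi> z) = f z / K" for z
    using K by (simp add: feq)
  have param: "c \<in> natural_params \<Psi>"
    unfolding natural_params_def mem_Collect_eq expeq using int by simp
  have "(\<integral>z. exp (- c * \<Psi> z) \<partial>lborel) = 1 / K"
    unfolding expeq using one by simp
  hence "f = (\<lambda>x. exp (- c * \<Psi> x) / (\<integral>z. exp (- c * \<Psi> z) \<partial>lborel))"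
    using feq by (simp add: fun_eq_iff)
  with param show ?thesis unfolding exp_family_def by blast
qed

lemma phi_proportional_if_exp_family:
  assumes f: "symmetric_pdf f" and prim: "is_primitive \<Psi> g" and "f \<in> exp_family \<Psi>"
  shows "\<exists>a. \<forall>z. phi f z = a * g z"
proof -
  obtain a where fa: "f = (\<lambda>x. exp (- a * \<Psi> x) / (\<integral>z. exp (- a * \<Psi> z) \<partial>lborel))"
    using assms(3) by (auto simp: exp_family_def)
  define N where "N = (\<integral>z. exp (- a * \<Psi> z) \<partial>lborel)"
  have fN: "f = (\<lambda>x. exp (- a * \<Psi> x) / N)" using fa by (simp add: N_def)
  have "f z > 0" for z using f by (rule symmetric_pdf_pos)
  hence "N \<noteq> 0" unfolding fN by fastforce
  have "phi f z = a * g z" for z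
  proof -
    have "(f has_real_derivative - a * g z * f z) (at z)"
      unfolding fN using prim \<open>N \<noteq> 0\<close>
      by (auto simp: is_primitive_def field_simps intro!: derivative_eq_intros)
    hence "deriv f z = - a * g z * f z" by (rule DERIV_imp_deriv)
    thus ?thesis using \<open>\<And>z. f z > 0\<close>[of z] by (simp add: phi_def)
  qed
  thus ?thesis by blast
qed

text \<open>Both singularity criteria reduce to this one.\<close>

lemma gram_eq_iff_exp_family:
  assumes f: "symmetric_pdf f" and A1: "A1 f" and A2: "A2_plus f P"
    and nz: "\<not> (AE z in lborel. psi P z = 0)"
    and prim: "is_primitive \<Psi> (psi P)"
  shows "I_info f * (\<integral>z. (psi P z)\<^sup>2 * f z \<partial>lborel)
      = (\<integral>z. phi f z * psi P z * f z \<partial>lborel)\<^sup>2 \<longleftrightarrow> f \<in> exp_family \<Psi>" (is "?gram \<longleftrightarrow> _")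
proof
  have pos: "f z > 0" for z using f by (rule symmetric_pdf_pos)
  assume ?gram
  have "f \<in> borel_measurable borel"
    using f by (auto simp: symmetric_pdf_def is_pdf_def has_bochner_integral_iff)
  moreover have "phi f \<in> borel_measurable borel"
    by (rule borel_measurable_derivative[OF minus_ln_has_derivative_phi[OF pos A1]])
  moreover have "psi P \<in> borel_measurable borel"
    using prim by (intro borel_measurable_derivative[of \<Psi>]) (simp add: is_primitive_def)
  ultimately obtain c where "AE z in lborel. phi f z = c * psi P z"
    using AE_proportional_if_gram_eq[of f "phi f" "psi P", OF pos] A1 A2 nz \<open>?gram\<close>
    by (auto simp: A1_def A2_plus_def I_info_def)
  thus "f \<in> exp_family \<Psi>"
    by (rule exp_family_if_AE_phi_proportional[OF f A1 prim])
next
  assume "f \<in> exp_family \<Psi>"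
  then obtain a where a: "\<And>z. phi f z = a * psi P z"
    using phi_proportional_if_exp_family[OF f prim] by blast
  have "I_info f = a\<^sup>2 * (\<integral>z. (psi P z)\<^sup>2 * f z \<partial>lborel)"
    by (simp add: I_info_def a power_mult_distrib mult.assoc)
  moreover have "(\<integral>z. phi f z * psi P z * f z \<partial>lborel) = a * (\<integral>z. (psi P z)\<^sup>2 * f z \<partial>lborel)"
    by (simp add: a power2_eq_square mult.assoc)
  ultimately show ?gram
    by (simp add: power2_eq_square)
qed

section \<open>The determinants\<close>

lemma J_info_nonzero:
  assumes f: "symmetric_pdf f" and A1: "A1_plus f"
  shows "J_info f \<noteq> 0"
proof
  have pos: "f z > 0" for z using f by (rule symmetric_pdf_pos)
  assume "J_info f = 0"
  hence "AE z in lborel. z * phi f z - 1 = 0"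
    using AE_zero_if_weighted_square_integral_zero[of f "\<lambda>z. z * phi f z - 1", OF pos] A1
    by (auto simp: A1_plus_def J_info_def)
  hence "AE z in lborel. f z + z * deriv f z = 0"
    by eventually_elim (use pos in \<open>auto simp: phi_def field_simps less_le\<close>)
  moreover have "((\<lambda>z. z * f z) has_real_derivative (f z + z * deriv f z)) (at z)" for z
  proof -
    have "(f has_real_derivative deriv f z) (at z)"
      using A1 by (simp add: A1_plus_def A1_def DERIV_deriv_iff_real_differentiable)
    thus ?thesis by (auto intro!: derivative_eq_intros)
  qed
  ultimately have "1 * f 1 = 0 * f 0"
    using constant_if_derivative_AE_zero[of "\<lambda>z. z * f z" "\<lambda>z. f z + z * deriv f z" 1 0] by blast
  thus False using pos[of 1] by simp
qed

lemma singular_fisher_Gamma0_iff: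
  assumes "\<sigma> > 0"
  shows "singular (fisher_Gamma0 f P \<mu> \<sigma>) \<longleftrightarrow>
    I_info f * (\<integral>z. (psi P z)\<^sup>2 * f z \<partial>lborel) = (\<integral>z. phi f z * psi P z * f z \<partial>lborel)\<^sup>2"
proof -
  have "det (fisher_Gamma0 f P \<mu> \<sigma>) = 4 / \<sigma>\<^sup>2 *
      (I_info f * (\<integral>z. (psi P z)\<^sup>2 * f z \<partial>lborel) - (\<integral>z. phi f z * psi P z * f z \<partial>lborel)\<^sup>2)"
    by (simp add: fisher_Gamma0_def det_2 vector_2 gamma11_def gamma13_def gamma33_def
        right_diff_distrib power2_eq_square)
  thus ?thesis
    using assms by (simp add: singular_def invertible_det_nz)
qed

lemma singular_fisher_Gamma_iff:
  assumes "\<sigma> > 0"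
  shows "singular (fisher_Gamma f P \<mu> \<sigma>) \<longleftrightarrow>
    J_info f = 0 \<or> singular (fisher_Gamma0 f P \<mu> \<sigma>)"
proof -
  have "det (fisher_Gamma f P \<mu> \<sigma>) = gamma22 f \<sigma> * det (fisher_Gamma0 f P \<mu> \<sigma>)"
    by (simp add: fisher_Gamma_def fisher_Gamma0_def det_2 det_3 vector_2 vector_3 algebra_simps)
  thus ?thesis
    using assms by (simp add: singular_def invertible_det_nz gamma22_def)
qed

theorem mainTheorem3:
  fixes D :: "(real \<Rightarrow> real) set" and s :: "(real \<Rightarrow> real) \<Rightarrow> real"
    and f :: "real \<Rightarrow> real" and P :: "real \<Rightarrow> real \<Rightarrow> real" and \<Psi> :: "real \<Rightarrow> real"
  assumes "scale_functional D s"
    and "symmetric_kernel D s f"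
    and "skewing_function P"
    and "\<not> (AE z in lborel. psi P z = 0)"
    and "is_primitive \<Psi> (psi P)"
  shows "(A1_plus f \<and> A2_plus f P \<longrightarrow>
            ((\<forall>\<mu> \<sigma>. \<sigma> > 0 \<longrightarrow> singular (fisher_Gamma f P \<mu> \<sigma>)) \<longleftrightarrow> f \<in> exp_family \<Psi>)) \<and>
         (A1 f \<and> A2_plus f P \<longrightarrow>
            ((\<forall>\<mu> \<sigma>. \<sigma> > 0 \<longrightarrow> singular (fisher_Gamma0 f P \<mu> \<sigma>)) \<longleftrightarrow> f \<in> exp_family \<Psi>))"
proof -
  have f: "symmetric_pdf f" using assms(2) by (simp add: symmetric_kernel_def)
  have Gamma0: "singular (fisher_Gamma0 f P \<mu> \<sigma>) \<longleftrightarrow> f \<in> exp_family \<Psi>"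
    if "A1 f" "A2_plus f P" "\<sigma> > 0" for \<mu> \<sigma>
    using singular_fisher_Gamma0_iff[OF that(3)]
      gram_eq_iff_exp_family[OF f that(1,2) assms(4,5)] by simp
  have Gamma: "singular (fisher_Gamma f P \<mu> \<sigma>) \<longleftrightarrow> f \<in> exp_family \<Psi>"
    if "A1_plus f" "A2_plus f P" "\<sigma> > 0" for \<mu> \<sigma>
    using singular_fisher_Gamma_iff[OF that(3)] J_info_nonzero[OF f that(1)]
      Gamma0[OF _ that(2,3)] that(1) by (simp add: A1_plus_def)
  show ?thesis
    using Gamma Gamma0 zero_less_one by blast
qed

end
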